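(* Let $\underline R$ be a commutative square ring. A map $f:(M,A)\to(N,B)$ between two $\underline R$-CP-modules is $\underline R$-CP-quadratic if and only if it satisfies the following properties: (1) $f(A)$, $\operatorname{Im}_{\underline R}d_f$ and $\operatorname{Im}_{\underline R}f_{(r)}$ are contained in $B$ for all $r\in R_e$; (2) the additive defect $d_f$ is $\underline R$-bilinear; (3) $f_{(r)}(m\cdot s)=f_{(r)}(m)\cdot s^2$ for all $m\in M$, $r,s\in R_e$; (4) $d_f(M,A)=d_f(A,M)=0$ and $f_{(r)}(A)=0$ for all $r\in R_e$.
   Context: A square ring $\underline R=(R_e\xrightarrow{H}R_{ee}\xrightarrow{P}R_e)$ consists of: a set $R_e$ with a group structure $+$ (not necessarily commutative) and an associative unital multiplication satisfying $r(s+t)=rs+rt$ (the law $(r+s)t=rt+st$ is not required); an abelian group $R_{ee}$; a map $R_e\times R_e\times R_{ee}\times R_e\to R_{ee}$, $(r,s,x,t)\mapsto(r,s)\cdot x\cdot t$, additive in each of its four variables and defining commuting actions on $R_{ee}$ of the multiplicative monoids $R_e\times R_e$ (on the left) and $R_e$ (on the right) (write $(r,s)\cdot x$ if $t=1$ and $x\cdot t$ if $r=s=1$); a group homomorphism $T:R_{ee}\to R_{ee}$ with $T^2=\mathrm{Id}$; a map $H:R_e\to R_{ee}$ and a group homomorphism $P:R_{ee}\to R_e$; such that for all $r,s,t\in R_e$, $x,y\in R_{ee}$: $PHP=P+P$; $P((r,r)\cdot x\cdot s)=rP(x)s$; $T=HP-\mathrm{Id}$; $PT=P$; $(P(x),r)\cdot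 y=(r,P(x))\cdot y=0=y\cdot P(x)$; $H(r+s)=H(r)+H(s)+(s,r)\cdot H(2)$ where $2=1+1$; $H(rs)=(r,r)\cdot H(s)+H(r)\cdot s$; $(r+s)t=rt+st+P((r,s)\cdot H(t))$; $T((r,s)\cdot x\cdot t)=(s,r)\cdot T(x)\cdot t$. The quotient $\overline R=R_e/\operatorname{Im}P$ is a ring. $\underline R$ is commutative if $\overline R$ is commutative and $(r,1)\cdot x=(1,r)\cdot x=x\cdot r$ for all $r\in R_e$, $x\in R_{ee}$. A (right) $\underline R$-BHP-module is a group $M$ (written additively, not necessarily commutative) with operations $M\times R_e\to M$, $(m,r)\mapsto m\cdot r$ and $M\times M\times R_{ee}\to M$, $(m,n,x)\mapsto[m,n]\cdot x$ such that: $m\cdot1=m$, $(m\cdot r)\cdot s=m\cdot(rs)$, $m\cdot(r+s)=m\cdot r+m\cdot s$; $(m+n)\cdot r=m\cdot r+n\cdot r+[m,n]\cdot H(r)$; $m\cdot P(x)=[m,m]\cdot x$; $[m,n]\cdot T(x)=[n,m]\cdot x$; $[m,n]\cdot x$ is additive in each of $m,n,x$; $([m\cdot r,n\cdot s]\cdot x)\cdot t=[m,n]\cdot((r,s)\cdot x\cdot t)$; $[[m,m']\cdot x,n]\cdot y=0$. An $\underline R$-CP-module is a pair $(M,A)$ where $M$ is an $\underline R$-BHP-module and $A$ is a subgroup of $M$, stable under the action of $R_e$, such that $[m,n]\cdot x=0$ whenever $m\in A$, and $[m,n]\cdot x\in A$ for all $m,n\in M$, $x\in R_{ee}$. A map between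 BHP-modules is $\underline R$-linear if it is additive and commutes with the operations $\cdot r$ ($r\in R_e$) and $[-,-]\cdot x$ ($x\in R_{ee}$); a map $M\times M\to N$ is $\underline R$-bilinear if it is $\underline R$-linear in each variable separately. For a map $f:M\to N$ of BHP-modules put $d_f(m,m')=f(m+m')-f(m')-f(m)$ (additive defect); $f_{(r)}(m)=f(m\cdot r)-f(m)\cdot r$ for $r\in R_e$ (scalar defects); $f_{[x]}(m,m')=f([m,m']\cdot x)-[f(m),f(m')]\cdot x$ for $x\in R_{ee}$. For a map $g$ from a set to a BHP-module $N$, $\operatorname{Im}_{\underline R}g$ is the smallest subgroup of $N$ containing the image of $g$ and stable under the operations of $R_e$ and $R_{ee}$. For $\underline R$ commutative, a map $f:(M,A)\to(N,B)$ of $\underline R$-CP-modules (i.e. a map $f:M\to N$) is $\underline R$-CP-quadratic if: (i) $f(A)$, $\operatorname{Im}_{\underline R}d_f$, $\operatorname{Im}_{\underline R}f_{(r)}$, $\operatorname{Im}_{\underline R}f_{[x]}$ are contained in $B$ for all $r\in R_e,x\in R_{ee}$; (ii) $d_f$ and all $f_{[x]}$ are $\underline R$-bilinear; (iii) $f_{(r)}(m\cdot s)=f_{(r)}(m)\cdot s^2$ for all $m\in M$, $r,s\in R_e$; (iv) $d_f(M,A)=d_f(A,M)=0$, $f_{(r)}(A)=0$, $f_{[x]}(M,A)=f_{[x]}(A,M)=0$ for all $r,x$. *)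

theory Defs
  imports "HOL-Algebra.Ring"
begin

text \<open>
  Carriers are types.  The class \<^class>\<open>group_add\<close> is the class of not necessarily
  commutative groups written additively, with \<open>a - b = a + (- b)\<close>.
\<close>

definition add_subgroup :: "'a::group_add set \<Rightarrow> bool" where
  "add_subgroup S \<longleftrightarrow> 0 \<in> S \<and> (\<forall>a\<in>S. \<forall>b\<in>S. a + b \<in> S) \<and> (\<forall>a\<in>S. - a \<in> S)"

definition add_hom :: "('a::group_add \<Rightarrow> 'b::group_add) \<Rightarrow> bool" where
  "add_hom f \<longleftrightarrow> (\<forall>a b. f (a + b) = f a + f b)"


section \<open>Square rings\<close>

text \<open>
  \<open>act r s x t\<close> stands for \<open>(r,s) \<cdot> x \<cdot> t\<close>; \<open>(r,s) \<cdot> x\<close> is \<open>act r s x 1\<close> and \<open>x \<cdot> t\<close> is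
  \<open>act 1 1 x t\<close>.  The axioms \<open>act_one\<close> and \<open>act_act\<close> together say that these are commuting
  unital actions, on the left of the monoid \<open>R\<^sub>e \<times> R\<^sub>e\<close> and on the right of \<open>R\<^sub>e\<close>.
\<close>

locale square_ring =
  fixes act :: "'r::{group_add,monoid_mult} \<Rightarrow> 'r \<Rightarrow> 'x::ab_group_add \<Rightarrow> 'r \<Rightarrow> 'x"
    and T :: "'x \<Rightarrow> 'x"
    and H :: "'r \<Rightarrow> 'x"
    and P :: "'x \<Rightarrow> 'r"
  assumes mult_add: "r * (s + t) = r * s + r * (t :: 'r)"
    and act_add1: "act (r + r') s x t = act r s x t + act r' s x t"
    and act_add2: "act r (s + s') x t = act r s x t + act r s' x t"
    and act_add3: "act r s (x + y) t = act r s x t + act r s y t"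
    and act_add4: "act r s x (t + t') = act r s x t + act r s x t'"
    and act_one: "act 1 1 x 1 = x"
    and act_act: "act r s (act r' s' x t') t = act (r * r') (s * s') x (t' * t)"
    and T_hom: "add_hom T"
    and T_T: "T (T x) = x"
    and P_hom: "add_hom P"
    and PHP: "P (H (P x)) = P x + P x"
    and P_act: "P (act r r x s) = r * P x * s"
    and T_eq: "T x = H (P x) - x"
    and P_T: "P (T x) = P x"
    and act_P1: "act (P x) r y 1 = 0"
    and act_P2: "act r (P x) y 1 = 0"
    and act_P3: "act 1 1 y (P x) = 0"
    and H_add: "H (r + s) = H r + H s + act s r (H (1 + 1)) 1"
    and H_mult: "H (r * s) = act r r (H s) 1 + act 1 1 (H r) s"
    and add_mult: "(r + s) * t = r * t + s * t + P (act r s (H t) 1)"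
    and T_act: "T (act r s x t) = act s r (T x) t"

text \<open>The ring \<open>R\<^sub>e / Im P\<close>, whose elements are the cosets of \<open>Im P\<close>.
  Being a ring is automatic (\<open>ring_quot_ring\<close> below), so that \<open>cring\<close> in
  \<open>comm_square_ring\<close> only adds commutativity of the multiplication.\<close>

definition im_coset :: "('x \<Rightarrow> 'r::group_add) \<Rightarrow> 'r \<Rightarrow> 'r set" where
  "im_coset P r = {r + P x | x. True}"

definition quot_ring :: "('x \<Rightarrow> 'r::{group_add,monoid_mult}) \<Rightarrow> 'r set ring" where
  "quot_ring P =
     \<lparr> carrier = range (im_coset P),
       monoid.mult = (\<lambda>A B. \<Union>a\<in>A. \<Union>b\<in>B. im_coset P (a * b)),
       one = im_coset P 1,
       zero = im_coset P 0,
       add = (\<lambda>A B. \<Union>a\<in>A. \<Union>b\<in>B. im_coset P (a + b)) \<rparr>"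

context square_ring
begin

lemma P_add: "P (x + y) = P x + P y"
  using P_hom by (simp add: add_hom_def)

lemma P_0: "P 0 = 0"
  using P_add[of 0 0] add_left_imp_eq[of "P 0" "P 0" 0] by simp

lemma P_minus: "P (- x) = - P x"
  using P_add[of x "- x"] by (simp add: P_0 minus_unique)

lemma im_coset_absorb: "im_coset P (r + P x) = im_coset P r"
proof -
  have "r + P x + P y = r + P (x + y)" for y
    by (simp add: P_add add.assoc)
  moreover have "r + P y = r + P x + P (- x + y)" for y
    by (simp only: add.assoc P_add[symmetric]) simp
  ultimately show ?thesis
    unfolding im_coset_def by blast
qed

lemma mult_one_one: "r * (1 + 1) = r + (r :: 'r)"
  by (simp add: mult_add)

lemma add_swap: "s + r = r + s + P (act r s (H (1 + 1)) 1)"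
proof -
  have P_central: "P x + u = u + P x" for x u
  proof -
    have "(u + P x) * (1 + 1) = u * (1 + 1) + P x * (1 + 1)"
      by (simp only: add_mult act_P2 P_0 add_0_right)
    then have "u + (P x + (u + P x)) = u + (u + (P x + P x))"
      by (simp add: mult_one_one add.assoc)
    then have "P x + u + P x = u + P x + P x"
      by (simp add: add.assoc)
    then show ?thesis by (rule add_right_imp_eq)
  qed
  let ?c = "P (act r s (H (1 + 1)) 1)"
  have "r + (s + (r + s)) = r + (r + (s + (s + ?c)))"
    using add_mult[of r s "1 + 1"] by (simp only: mult_one_one add.assoc)
  then have "s + r + s = r + s + ?c + s"
    by (simp add: add.assoc P_central[of _ s])
  then show ?thesis by (rule add_right_imp_eq)
qed

lemma P_central: "P x + u = u + P x"
  using add_swap[of "P x" u] by (simp add: act_P2 P_0)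

lemma UN_im_coset:
  assumes "\<And>x y. im_coset P (h (r + P x) (s + P y)) = C"
  shows "(\<Union>a\<in>im_coset P r. \<Union>b\<in>im_coset P s. im_coset P (h a b)) = C"
proof
  have "im_coset P (h a b) = C" if "a \<in> im_coset P r" "b \<in> im_coset P s" for a b
    using that assms unfolding im_coset_def by blast
  then show "(\<Union>a\<in>im_coset P r. \<Union>b\<in>im_coset P s. im_coset P (h a b)) \<subseteq> C"
    by blast
  show "C \<subseteq> (\<Union>a\<in>im_coset P r. \<Union>b\<in>im_coset P s. im_coset P (h a b))"
    unfolding assms[of 0 0, symmetric] by (auto simp: im_coset_def)
qed

lemma quot_add: "add (quot_ring P) (im_coset P r) (im_coset P s) = im_coset P (r + s)"
proof -
  have "r + P x + (s + P y) = r + s + P (x + y)" for x y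
  proof -
    have "r + P x + (s + P y) = r + (P x + s) + P y" by (simp only: add.assoc)
    then show ?thesis by (simp only: P_central[of x s] P_add add.assoc)
  qed
  then show ?thesis
    unfolding quot_ring_def ring.simps monoid.simps
    by (intro UN_im_coset) (simp add: im_coset_absorb)
qed

lemma quot_mult:
  "monoid.mult (quot_ring P) (im_coset P r) (im_coset P s) = im_coset P (r * s)"
proof -
  have 1: "(r + P x) * u = r * u + P (act 1 1 x u)" for x u
    using P_act[of 1 x u] by (simp add: add_mult act_P2 P_0)
  have 2: "r * (s + P y) = r * s + P (act r r y 1)" for y
    using P_act[of r y 1] by (simp add: mult_add)
  show ?thesis
    unfolding quot_ring_def ring.simps monoid.simps
    by (intro UN_im_coset) (simp add: 1 2 im_coset_absorb)
qed

lemma ring_quot_ring: "ring (quot_ring P)"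
proof -
  have c: "A \<in> carrier (quot_ring P) \<longleftrightarrow> (\<exists>r. A = im_coset P r)" for A
    by (auto simp: quot_ring_def)
  have z: "zero (quot_ring P) = im_coset P 0" and o: "one (quot_ring P) = im_coset P 1"
    by (simp_all add: quot_ring_def)
  have comm: "im_coset P (r + s) = im_coset P (s + r)" for r s
    by (metis add_swap im_coset_absorb)
  have dist: "im_coset P ((r + s) * t) = im_coset P (r * t + s * t)" for r s t
    by (simp add: add_mult im_coset_absorb)
  show ?thesis
  proof (rule ringI)
    show "abelian_group (quot_ring P)"
    proof (rule abelian_groupI)
      fix A B C
      assume "A \<in> carrier (quot_ring P)" "B \<in> carrier (quot_ring P)" "C \<in> carrier (quot_ring P)"
      then show "add (quot_ring P) (add (quot_ring P) A B) C
          = add (quot_ring P) A (add (quot_ring P) B C)"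
        by (auto simp: c quot_add add.assoc)
    next
      fix A B
      assume "A \<in> carrier (quot_ring P)" "B \<in> carrier (quot_ring P)"
      then show "add (quot_ring P) A B = add (quot_ring P) B A"
        using comm by (auto simp only: c quot_add)
    next
      fix A
      assume "A \<in> carrier (quot_ring P)"
      then obtain r where A: "A = im_coset P r" using c by blast
      show "\<exists>B\<in>carrier (quot_ring P). add (quot_ring P) B A = zero (quot_ring P)"
        by (rule bexI[of _ "im_coset P (- r)"]) (auto simp: A c z quot_add)
    qed (auto simp: c z quot_add)
    show "Group.monoid (quot_ring P)"
      by (rule monoidI) (auto simp: c o quot_mult mult.assoc)
  qed (auto simp: c quot_add quot_mult dist mult_add)
qed

end

locale comm_square_ring = square_ring act T H P
  for act :: "'r::{group_add,monoid_mult} \<Rightarrow> 'r \<Rightarrow> 'x::ab_group_add \<Rightarrow> 'r \<Rightarrow> 'x"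
    and T H P +
  assumes quot_comm: "cring (quot_ring P)"
    and act_comm: "act r 1 x 1 = act 1 r x 1"
    and act_left_right: "act 1 r x 1 = act 1 1 x r"


section \<open>Modules over square rings\<close>

text \<open>\<open>sm m r\<close> stands for \<open>m \<cdot> r\<close> and \<open>br m n x\<close> for \<open>[m,n] \<cdot> x\<close>.\<close>

locale BHP_module = square_ring act T H P
  for act :: "'r::{group_add,monoid_mult} \<Rightarrow> 'r \<Rightarrow> 'x::ab_group_add \<Rightarrow> 'r \<Rightarrow> 'x"
    and T H P +
  fixes sm :: "'m::group_add \<Rightarrow> 'r \<Rightarrow> 'm"
    and br :: "'m \<Rightarrow> 'm \<Rightarrow> 'x \<Rightarrow> 'm"
  assumes sm_one: "sm m 1 = m"
    and sm_sm: "sm (sm m r) s = sm m (r * s)"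
    and sm_add: "sm m (r + s) = sm m r + sm m s"
    and add_sm: "sm (m + n) r = sm m r + sm n r + br m n (H r)"
    and sm_P: "sm m (P x) = br m m x"
    and br_T: "br m n (T x) = br n m x"
    and br_add1: "br (m + m') n x = br m n x + br m' n x"
    and br_add2: "br m (n + n') x = br m n x + br m n' x"
    and br_add3: "br m n (x + y) = br m n x + br m n y"
    and br_sm: "sm (br (sm m r) (sm n s) x) t = br m n (act r s x t)"
    and br_br: "br (br m m' x) n y = 0"

locale CP_module = BHP_module act T H P sm br
  for act :: "'r::{group_add,monoid_mult} \<Rightarrow> 'r \<Rightarrow> 'x::ab_group_add \<Rightarrow> 'r \<Rightarrow> 'x"
    and T H P
    and sm :: "'m::group_add \<Rightarrow> 'r \<Rightarrow> 'm"
    and br :: "'m \<Rightarrow> 'm \<Rightarrow> 'x \<Rightarrow> 'm" +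
  fixes A :: "'m set"
  assumes A_subgroup: "add_subgroup A"
    and A_sm: "a \<in> A \<Longrightarrow> sm a r \<in> A"
    and A_br: "a \<in> A \<Longrightarrow> br a n x = 0"
    and br_in_A: "br m n x \<in> A"


section \<open>Linear and bilinear maps, defects\<close>

text \<open>
  The operations on the source are \<open>sm\<close>, \<open>br\<close>, those on the target \<open>sm'\<close>, \<open>br'\<close>.
\<close>

definition R_linear ::
  "('m::group_add \<Rightarrow> 'r \<Rightarrow> 'm) \<Rightarrow> ('m \<Rightarrow> 'm \<Rightarrow> 'x \<Rightarrow> 'm) \<Rightarrow>
   ('n::group_add \<Rightarrow> 'r \<Rightarrow> 'n) \<Rightarrow> ('n \<Rightarrow> 'n \<Rightarrow> 'x \<Rightarrow> 'n) \<Rightarrow> ('m \<Rightarrow> 'n) \<Rightarrow> bool" where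
  "R_linear sm br sm' br' f \<longleftrightarrow>
     add_hom f \<and>
     (\<forall>m r. f (sm m r) = sm' (f m) r) \<and>
     (\<forall>m n x. f (br m n x) = br' (f m) (f n) x)"

definition R_bilinear ::
  "('m::group_add \<Rightarrow> 'r \<Rightarrow> 'm) \<Rightarrow> ('m \<Rightarrow> 'm \<Rightarrow> 'x \<Rightarrow> 'm) \<Rightarrow>
   ('n::group_add \<Rightarrow> 'r \<Rightarrow> 'n) \<Rightarrow> ('n \<Rightarrow> 'n \<Rightarrow> 'x \<Rightarrow> 'n) \<Rightarrow> ('m \<Rightarrow> 'm \<Rightarrow> 'n) \<Rightarrow> bool" where
  "R_bilinear sm br sm' br' g \<longleftrightarrow>
     (\<forall>m'. R_linear sm br sm' br' (\<lambda>m. g m m')) \<and>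
     (\<forall>m. R_linear sm br sm' br' (\<lambda>m'. g m m'))"

definition add_defect :: "('m::group_add \<Rightarrow> 'n::group_add) \<Rightarrow> 'm \<Rightarrow> 'm \<Rightarrow> 'n" where
  "add_defect f m m' = f (m + m') - f m' - f m"

definition sm_defect ::
  "('m \<Rightarrow> 'r \<Rightarrow> 'm) \<Rightarrow> ('n::group_add \<Rightarrow> 'r \<Rightarrow> 'n) \<Rightarrow> ('m \<Rightarrow> 'n) \<Rightarrow> 'r \<Rightarrow> 'm \<Rightarrow> 'n" where
  "sm_defect sm sm' f r m = f (sm m r) - sm' (f m) r"

definition br_defect ::
  "('m \<Rightarrow> 'm \<Rightarrow> 'x \<Rightarrow> 'm) \<Rightarrow> ('n::group_add \<Rightarrow> 'n \<Rightarrow> 'x \<Rightarrow> 'n) \<Rightarrow> ('m \<Rightarrow> 'n) \<Rightarrow>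
   'x \<Rightarrow> 'm \<Rightarrow> 'm \<Rightarrow> 'n" where
  "br_defect br br' f x m m' = f (br m m' x) - br' (f m) (f m') x"

definition Im_R ::
  "('n::group_add \<Rightarrow> 'r \<Rightarrow> 'n) \<Rightarrow> ('n \<Rightarrow> 'n \<Rightarrow> 'x \<Rightarrow> 'n) \<Rightarrow> ('s \<Rightarrow> 'n) \<Rightarrow> 'n set" where
  "Im_R sm br g =
     \<Inter> {S. add_subgroup S \<and> (\<forall>n\<in>S. \<forall>r. sm n r \<in> S) \<and>
           (\<forall>n\<in>S. \<forall>n'\<in>S. \<forall>x. br n n' x \<in> S) \<and> range g \<subseteq> S}"


section \<open>Quadratic maps\<close>

definition CP_quadratic ::
  "('m::group_add \<Rightarrow> 'r::monoid_mult \<Rightarrow> 'm) \<Rightarrow> ('m \<Rightarrow> 'm \<Rightarrow> 'x \<Rightarrow> 'm) \<Rightarrow> 'm set \<Rightarrow>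
   ('n::group_add \<Rightarrow> 'r \<Rightarrow> 'n) \<Rightarrow> ('n \<Rightarrow> 'n \<Rightarrow> 'x \<Rightarrow> 'n) \<Rightarrow> 'n set \<Rightarrow> ('m \<Rightarrow> 'n) \<Rightarrow> bool" where
  "CP_quadratic sm br A sm' br' B f \<longleftrightarrow>
     (f ` A \<subseteq> B \<and>
      Im_R sm' br' (\<lambda>(m, m'). add_defect f m m') \<subseteq> B \<and>
      (\<forall>r. Im_R sm' br' (sm_defect sm sm' f r) \<subseteq> B) \<and>
      (\<forall>x. Im_R sm' br' (\<lambda>(m, m'). br_defect br br' f x m m') \<subseteq> B)) \<and>
     (R_bilinear sm br sm' br' (add_defect f) \<and>
      (\<forall>x. R_bilinear sm br sm' br' (br_defect br br' f x))) \<and>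
     (\<forall>m r s. sm_defect sm sm' f r (sm m s) = sm' (sm_defect sm sm' f r m) (s\<^sup>2)) \<and>
     ((\<forall>m. \<forall>a\<in>A. add_defect f m a = 0 \<and> add_defect f a m = 0) \<and>
      (\<forall>r. \<forall>a\<in>A. sm_defect sm sm' f r a = 0) \<and>
      (\<forall>x m. \<forall>a\<in>A. br_defect br br' f x m a = 0 \<and> br_defect br br' f x a m = 0))"

end

(* Since f is linear on A, and brackets take values in A and vanish on A, the defect
   f_[x] automatically takes values in B, is biadditive and vanishes on A.  Commutativity
   of the square ring gives [m r, n] x = ([m, n] x) r = [m, n r] x, and f(m r) differs
   from f(m) r by an element of B, which the bracket ignores; hence f_[x] is bilinear. *)
theory Submission imports Defs begin

context CP_module
begin

lemma A_add: "a \<in> A \<Longrightarrow> b \<in> A \<Longrightarrow> a + b \<in> A"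
  and A_uminus: "a \<in> A \<Longrightarrow> - a \<in> A"
  using A_subgroup by (simp_all add: add_subgroup_def)

lemma A_diff: "a \<in> A \<Longrightarrow> b \<in> A \<Longrightarrow> a - b \<in> A"
  using A_add[of a "- b"] A_uminus[of b] by simp

text \<open>\<open>T\<close> swaps the two bracket arguments, so this is the axiom
  \<open>A_br\<close> for the coefficient \<open>T x\<close>.\<close>

lemma A_br_right: "a \<in> A \<Longrightarrow> br n a x = 0"
  using A_br[of a n "T x"] br_T[of a n x] by simp

text \<open>Compare the two expansions of \<open>(a + n) \<cdot> 2\<close>.\<close>

lemma A_central:
  assumes "a \<in> A"
  shows "a + n = n + a"
proof -
  have double: "sm m (1 + 1) = m + m" for m
    by (simp add: sm_add sm_one)
  have "a + (n + (a + n)) = a + (a + (n + n))"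
    using add_sm[of a n "1 + 1"] assms by (simp add: double A_br add.assoc)
  then have "n + a + n = a + n + n"
    by (simp add: add.assoc)
  then show ?thesis
    by simp
qed

lemma A_add_sm: "a \<in> A \<Longrightarrow> sm (a + n) r = sm a r + sm n r"
  by (simp add: add_sm A_br)

text \<open>A scalar fails to be additive only by the bracket term with \<open>H r\<close>, which
  vanishes on \<open>A\<close>; apply this to \<open>(a - b) + b\<close>.\<close>

lemma A_diff_sm:
  assumes "a \<in> A" "b \<in> A"
  shows "sm (a - b) r = sm a r - sm b r"
  using A_add_sm[OF A_diff[OF assms], of b r] by (simp add: eq_diff_eq)

text \<open>\<open>A\<close> is itself one of the sets being intersected, since it is a subgroup
  closed under scalars and contains every bracket.\<close>

lemma Im_R_subset:
  assumes "range g \<subseteq> A"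
  shows "Im_R sm br g \<subseteq> A"
  unfolding Im_R_def by (rule Inter_lower) (simp add: A_subgroup A_sm br_in_A assms)

text \<open>The two sides are \<open>[m,n]\<close> with coefficients \<open>act r 1 x 1\<close> and
  \<open>act 1 1 x r\<close>; commutativity equates both with \<open>act 1 r x 1\<close>.\<close>

lemma br_sm_left:
  assumes "comm_square_ring act T H P"
  shows "br (sm m r) n x = sm (br m n x) r"
  using br_sm[of m r n 1 x 1] br_sm[of m 1 n 1 x r]
    comm_square_ring.act_comm[OF assms, of r x] comm_square_ring.act_left_right[OF assms, of r x]
  by (simp add: sm_one)

lemma br_sm_right:
  assumes "comm_square_ring act T H P"
  shows "br m (sm n r) x = sm (br m n x) r"
  using br_sm[of m 1 n r x 1] br_sm[of m 1 n 1 x r]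
    comm_square_ring.act_left_right[OF assms, of r x]
  by (simp add: sm_one)

end

lemma in_Im_R: "g s \<in> Im_R sm br g"
  unfolding Im_R_def by (rule InterI) auto

text \<open>Pointwise consequences of conditions (1) and (4). Together with commutativity of the
  square ring they yield all clauses on \<open>br_defect\<close>.\<close>

locale CP_map =
  M: CP_module act T H P sm\<^sub>M br\<^sub>M A + N: CP_module act T H P sm\<^sub>N br\<^sub>N B
  for act :: "'r::{group_add,monoid_mult} \<Rightarrow> 'r \<Rightarrow> 'x::ab_group_add \<Rightarrow> 'r \<Rightarrow> 'x"
    and T :: "'x \<Rightarrow> 'x" and H :: "'r \<Rightarrow> 'x" and P :: "'x \<Rightarrow> 'r"
    and sm\<^sub>M :: "'m::group_add \<Rightarrow> 'r \<Rightarrow> 'm" and br\<^sub>M :: "'m \<Rightarrow> 'm \<Rightarrow> 'x \<Rightarrow> 'm" and A :: "'m set"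
    and sm\<^sub>N :: "'n::group_add \<Rightarrow> 'r \<Rightarrow> 'n" and br\<^sub>N :: "'n \<Rightarrow> 'n \<Rightarrow> 'x \<Rightarrow> 'n" and B :: "'n set" +
  fixes f :: "'m \<Rightarrow> 'n"
  assumes f_A: "a \<in> A \<Longrightarrow> f a \<in> B"
    and add_defect_in_B: "add_defect f m n \<in> B"
    and sm_defect_in_B: "sm_defect sm\<^sub>M sm\<^sub>N f r m \<in> B"
    and add_defect_A: "a \<in> A \<Longrightarrow> add_defect f a m = 0"
    and sm_defect_A: "a \<in> A \<Longrightarrow> sm_defect sm\<^sub>M sm\<^sub>N f r a = 0"
begin

lemma f_add: "f (m + n) = add_defect f m n + (f m + f n)"
  by (simp add: add_defect_def flip: add.assoc)

lemma f_sm: "f (sm\<^sub>M m r) = sm_defect sm\<^sub>M sm\<^sub>N f r m + sm\<^sub>N (f m) r"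
  by (simp add: sm_defect_def)

lemma f_A_add: "a \<in> A \<Longrightarrow> f (a + m) = f a + f m"
  by (simp add: f_add add_defect_A)

lemma f_A_sm: "a \<in> A \<Longrightarrow> f (sm\<^sub>M a r) = sm\<^sub>N (f a) r"
  by (simp add: f_sm sm_defect_A)

lemma f_0: "f 0 = 0"
proof -
  have "0 \<in> A"
    using M.A_subgroup by (simp add: add_subgroup_def)
  then have "f 0 + f 0 = f 0 + 0"
    using f_A_add[of 0 0] by simp
  then show ?thesis
    by (rule add_left_imp_eq)
qed

text \<open>The additive defect lies in \<open>B\<close>, and brackets kill
  \<open>B\<close>.\<close>

lemma br_f_add_left: "br\<^sub>N (f (m + m')) n x = br\<^sub>N (f m) n x + br\<^sub>N (f m') n x"
  by (simp add: f_add N.br_add1 N.A_br[OF add_defect_in_B])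

lemma br_f_add_right: "br\<^sub>N n (f (m + m')) x = br\<^sub>N n (f m) x + br\<^sub>N n (f m') x"
  by (simp add: f_add N.br_add2 N.A_br_right[OF add_defect_in_B])

lemma br_f_sm_left: "br\<^sub>N (f (sm\<^sub>M m r)) n x = br\<^sub>N (sm\<^sub>N (f m) r) n x"
  by (simp add: f_sm N.br_add1 N.A_br[OF sm_defect_in_B])

lemma br_f_sm_right: "br\<^sub>N n (f (sm\<^sub>M m r)) x = br\<^sub>N n (sm\<^sub>N (f m) r) x"
  by (simp add: f_sm N.br_add2 N.A_br_right[OF sm_defect_in_B])

lemma br_defect_in_B: "br_defect br\<^sub>M br\<^sub>N f x m n \<in> B"
  by (simp add: br_defect_def N.A_diff f_A M.br_in_A N.br_in_A)

text \<open>Since \<open>f a\<close> lies in \<open>B\<close>, both brackets vanish, and what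
  remains is \<open>f 0 = 0\<close>.\<close>

lemma br_defect_A_left: "a \<in> A \<Longrightarrow> br_defect br\<^sub>M br\<^sub>N f x a m = 0"
  by (simp add: br_defect_def M.A_br N.A_br f_A f_0)

lemma br_defect_A_right: "a \<in> A \<Longrightarrow> br_defect br\<^sub>M br\<^sub>N f x m a = 0"
  by (simp add: br_defect_def M.A_br_right N.A_br_right f_A f_0)

text \<open>Negating a sum reverses its order in a noncommutative group; centrality of
  \<open>B\<close> undoes this.\<close>

lemma B_add_diff_add:
  assumes "c \<in> B" "d \<in> B" "c' \<in> B" "d' \<in> B"
  shows "(c + d) - (c' + d') = (c - c') + (d - d')"
proof -
  \<comment> \<open>Once \<open>c' + d'\<close> is added on the right, moving \<open>c'\<close> past
    \<open>d - d'\<close> lets everything telescope.\<close>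
  have "(c - c') + (d - d') + (c' + d') = c - c' + (d - d' + c') + d'"
    by (simp only: add.assoc)
  also have "d - d' + c' = c' + (d - d')"
    using assms by (intro N.A_central N.A_diff)
  also have "c - c' + (c' + (d - d')) + d' = c + d"
    by (simp flip: add.assoc) (simp add: add.assoc)
  finally show ?thesis
    by (simp only: diff_eq_eq)
qed

lemma br_defect_add_left:
  "br_defect br\<^sub>M br\<^sub>N f x (m + m') n =
    br_defect br\<^sub>M br\<^sub>N f x m n + br_defect br\<^sub>M br\<^sub>N f x m' n"
  unfolding br_defect_def M.br_add1 br_f_add_left f_A_add[OF M.br_in_A]
  by (intro B_add_diff_add f_A M.br_in_A N.br_in_A)

lemma br_defect_add_right:
  "br_defect br\<^sub>M br\<^sub>N f x m (n + n') =
    br_defect br\<^sub>M br\<^sub>N f x m n + br_defect br\<^sub>M br\<^sub>N f x m n'"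
  unfolding br_defect_def M.br_add2 br_f_add_right f_A_add[OF M.br_in_A]
  by (intro B_add_diff_add f_A M.br_in_A N.br_in_A)

text \<open>Brackets lie in \<open>A\<close>, where \<open>f\<close> commutes with scalars, so
  \<open>r\<close> can be pulled out of both terms and then out of their difference in
  \<open>B\<close>.\<close>

lemma br_defect_sm_left:
  assumes "comm_square_ring act T H P"
  shows "br_defect br\<^sub>M br\<^sub>N f x (sm\<^sub>M m r) n = sm\<^sub>N (br_defect br\<^sub>M br\<^sub>N f x m n) r"
  unfolding br_defect_def br_f_sm_left M.br_sm_left[OF assms] N.br_sm_left[OF assms]
    f_A_sm[OF M.br_in_A]
  by (intro N.A_diff_sm[symmetric] f_A M.br_in_A N.br_in_A)

lemma br_defect_sm_right:
  assumes "comm_square_ring act T H P"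
  shows "br_defect br\<^sub>M br\<^sub>N f x m (sm\<^sub>M n r) = sm\<^sub>N (br_defect br\<^sub>M br\<^sub>N f x m n) r"
  unfolding br_defect_def br_f_sm_right M.br_sm_right[OF assms] N.br_sm_right[OF assms]
    f_A_sm[OF M.br_in_A]
  by (intro N.A_diff_sm[symmetric] f_A M.br_in_A N.br_in_A)

text \<open>Compatibility with brackets reads \<open>0 = 0\<close>: the defect vanishes when an
  argument is a bracket, hence in \<open>A\<close>, and its values lie in \<open>B\<close>, so their
  brackets vanish.\<close>

lemma br_defect_bilinear:
  assumes "comm_square_ring act T H P"
  shows "R_bilinear sm\<^sub>M br\<^sub>M sm\<^sub>N br\<^sub>N (br_defect br\<^sub>M br\<^sub>N f x)"
  unfolding R_bilinear_def R_linear_def add_hom_def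
  by (simp add: br_defect_add_left br_defect_add_right
      br_defect_sm_left[OF assms] br_defect_sm_right[OF assms]
      br_defect_A_left[OF M.br_in_A] br_defect_A_right[OF M.br_in_A] N.A_br[OF br_defect_in_B])

end

theorem mainTheorem11:
  fixes act :: "'r::{group_add,monoid_mult} \<Rightarrow> 'r \<Rightarrow> 'x::ab_group_add \<Rightarrow> 'r \<Rightarrow> 'x"
    and T :: "'x \<Rightarrow> 'x" and H :: "'r \<Rightarrow> 'x" and P :: "'x \<Rightarrow> 'r"
    and sm\<^sub>M :: "'m::group_add \<Rightarrow> 'r \<Rightarrow> 'm" and br\<^sub>M :: "'m \<Rightarrow> 'm \<Rightarrow> 'x \<Rightarrow> 'm" and A :: "'m set"
    and sm\<^sub>N :: "'n::group_add \<Rightarrow> 'r \<Rightarrow> 'n" and br\<^sub>N :: "'n \<Rightarrow> 'n \<Rightarrow> 'x \<Rightarrow> 'n" and B :: "'n set"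
    and f :: "'m \<Rightarrow> 'n"
  assumes "comm_square_ring act T H P"
    and "CP_module act T H P sm\<^sub>M br\<^sub>M A"
    and "CP_module act T H P sm\<^sub>N br\<^sub>N B"
  shows "CP_quadratic sm\<^sub>M br\<^sub>M A sm\<^sub>N br\<^sub>N B f \<longleftrightarrow>
    (f ` A \<subseteq> B \<and>
     Im_R sm\<^sub>N br\<^sub>N (\<lambda>(m, m'). add_defect f m m') \<subseteq> B \<and>
     (\<forall>r. Im_R sm\<^sub>N br\<^sub>N (sm_defect sm\<^sub>M sm\<^sub>N f r) \<subseteq> B)) \<and>
    R_bilinear sm\<^sub>M br\<^sub>M sm\<^sub>N br\<^sub>N (add_defect f) \<and>
    (\<forall>m r s. sm_defect sm\<^sub>M sm\<^sub>N f r (sm\<^sub>M m s) = sm\<^sub>N (sm_defect sm\<^sub>M sm\<^sub>N f r m) (s\<^sup>2)) \<and>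
    ((\<forall>m. \<forall>a\<in>A. add_defect f m a = 0 \<and> add_defect f a m = 0) \<and>
     (\<forall>r. \<forall>a\<in>A. sm_defect sm\<^sub>M sm\<^sub>N f r a = 0))"
    (is "_ \<longleftrightarrow> ?R")
proof
  assume ?R
  interpret M: CP_module act T H P sm\<^sub>M br\<^sub>M A by fact
  interpret N: CP_module act T H P sm\<^sub>N br\<^sub>N B by fact
  \<comment> \<open>The inclusions of the generated submodules are turned into the pointwise
    memberships that \<open>CP_map\<close> asks for.\<close>
  have "add_defect f m n \<in> B" for m n
    using \<open>?R\<close> in_Im_R[of "\<lambda>(m, n). add_defect f m n" "(m, n)" sm\<^sub>N br\<^sub>N]
    by (simp add: subset_iff)
  moreover have "sm_defect sm\<^sub>M sm\<^sub>N f r m \<in> B" for r m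
    using \<open>?R\<close> in_Im_R[of "sm_defect sm\<^sub>M sm\<^sub>N f r" m sm\<^sub>N br\<^sub>N]
    by (simp add: subset_iff)
  ultimately interpret CP_map act T H P sm\<^sub>M br\<^sub>M A sm\<^sub>N br\<^sub>N B f
    using \<open>?R\<close> by unfold_locales auto
  have "Im_R sm\<^sub>N br\<^sub>N (\<lambda>(m, n). br_defect br\<^sub>M br\<^sub>N f x m n) \<subseteq> B" for x
    by (rule N.Im_R_subset) (auto simp: br_defect_in_B)
  with \<open>?R\<close> show "CP_quadratic sm\<^sub>M br\<^sub>M A sm\<^sub>N br\<^sub>N B f"
    unfolding CP_quadratic_def
    by (simp add: br_defect_bilinear[OF assms(1)] br_defect_A_left br_defect_A_right)
\<comment> \<open>The forward implication only discards the clauses on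
  \<open>br_defect\<close>.\<close>
qed (simp add: CP_quadratic_def)

end
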